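(* Let $k\ge1$ be an integer and $p\ge1$ real. Let $\mathcal X_n=(\mathbb X_n,d_n,\mu_n)$, $n\ge1$, and $\mathcal X=(\mathbb X,d,\mu)$ be compact normalized metric measure spaces such that $\mathcal X_n\to\mathcal X$ in the measured Gromov–Hausdorff sense, and let $h_n\colon\mathbb X_n\to\mathbb X$ be any sequence of $\varepsilon_n$-isometries realizing this convergence (i.e. $\varepsilon_n\to0$ and $(h_n)_{\#}\mu_n\to\mu$ weakly). Assume that the set $\mathcal S_{\mathcal X}(k)$ of $k$-means of $\mathcal X$ is finite. Put $$\mathcal U_n=\bigcup_{S_n\in\mathcal S_{\mathcal X_n}(k)}\mathcal V(h_n(S_n)),\qquad \mathcal U=\bigcup_{S\in\mathcal S_{\mathcal X}(k)}\mathcal V(S),$$ where all Voronoi cells are taken in $(\mathbb X,d)$. Then $$\lim_{n\to\infty}\ \sup_{V\in\mathcal U_n}\ \min_{W\in\mathcal U}\ \max_{v\in V} d(v,W)=0 .$$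
   Context: A normalized metric measure space is a metric space with a Borel probability measure. A map $h\colon(\mathbb X,d_{\mathbb X})\to(\mathbb Y,d_{\mathbb Y})$ is an $\varepsilon$-isometry if $|d_{\mathbb X}(x,x')-d_{\mathbb Y}(h(x),h(x'))|<\varepsilon$ for all $x,x'\in\mathbb X$, and $d_{\mathbb Y}(y,h(\mathbb X))<\varepsilon$ for all $y\in\mathbb Y$. Compact normalized metric measure spaces $(\mathbb X_n,d_n,\mu_n)$ converge to $(\mathbb X,d,\mu)$ in the measured Gromov–Hausdorff sense if there are $\varepsilon_n\to0$ and (Borel measurable) $\varepsilon_n$-isometries $h_n\colon\mathbb X_n\to\mathbb X$ with $(h_n)_{\#}\mu_n\to\mu$ weakly. For a compact metric space $(\mathbb Y,d_{\mathbb Y})$, $C_k(\mathbb Y)$ is the set of all nonempty subsets of $\mathbb Y$ of cardinality at most $k$. For a Borel probability measure $\mu$ on $\mathbb Y$ put $\Phi_{\mathbb Y}(S,\mu)=\int_{\mathbb Y}\min_{x\in S}d_{\mathbb Y}(y,x)^p\,\mu(dy)$. For $\mathcal Y=(\mathbb Y,d_{\mathbb Y},\mu)$, the set of $k$-means $\mathcal S_{\mathcal Y}(k)$ is the set of minimizers of $\Phi_{\mathbb Y}(\cdot,\mu)$ over $C_k(\mathbb Y)$. For a finite nonempty $S\subset\mathbb X$ and $b\in S$, the Voronoi cell of $b$ is $V_b=\{x\in\mathbb X: d(x,b)\le d(x,b')\ \text{for all }b'\in S\}$, and $\mathcal V(S)=\{V_b:b\in S\}$. Also $d(v,W)=\inf_{w\in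 W}d(v,w)$. *)

theory Defs
  imports "HOL-Analysis.Analysis" "HOL-Probability.Probability_Measure"
begin

text \<open>
  Metric spaces are values of type \<open>'a metric\<close>, so that a sequence of spaces with varying
  carriers can be a function of the index.
\<close>

definition borel_metric :: "'a metric \<Rightarrow> 'a measure" where
  "borel_metric X = sigma (mspace X) {U. openin (mtopology_of X) U}"

definition compact_normalized_mm_space :: "'a metric \<Rightarrow> 'a measure \<Rightarrow> bool" where
  "compact_normalized_mm_space X \<mu> \<longleftrightarrow>
     compact_space (mtopology_of X) \<and> prob_space \<mu> \<and> sets \<mu> = sets (borel_metric X)"

definition point_dist :: "'a metric \<Rightarrow> 'a \<Rightarrow> 'a set \<Rightarrow> real" where
  "point_dist X v W = (INF w\<in>W. mdist X v w)"

definition eps_isometry :: "real \<Rightarrow> 'a metric \<Rightarrow> 'b metric \<Rightarrow> ('a \<Rightarrow> 'b) \<Rightarrow> bool" where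
  "eps_isometry \<epsilon> X Y h \<longleftrightarrow>
     h \<in> mspace X \<rightarrow> mspace Y \<and>
     (\<forall>x\<in>mspace X. \<forall>x'\<in>mspace X. \<bar>mdist X x x' - mdist Y (h x) (h x')\<bar> < \<epsilon>) \<and>
     (\<forall>y\<in>mspace Y. point_dist Y y (h ` mspace X) < \<epsilon>)"

definition weakly_converges :: "'a metric \<Rightarrow> (nat \<Rightarrow> 'a measure) \<Rightarrow> 'a measure \<Rightarrow> bool" where
  "weakly_converges X \<nu> \<mu> \<longleftrightarrow>
     (\<forall>f. continuous_map (mtopology_of X) euclideanreal f \<and> bounded (f ` mspace X) \<longrightarrow>
        (\<lambda>n. LINT x|\<nu> n. f x) \<longlonglongrightarrow> (LINT x|\<mu>. f x))"

definition realizes_mGH_convergence ::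
    "(nat \<Rightarrow> 'a metric) \<Rightarrow> (nat \<Rightarrow> 'a measure) \<Rightarrow> 'b metric \<Rightarrow> 'b measure \<Rightarrow>
     (nat \<Rightarrow> real) \<Rightarrow> (nat \<Rightarrow> 'a \<Rightarrow> 'b) \<Rightarrow> bool" where
  "realizes_mGH_convergence Xs \<mu>s X \<mu> \<epsilon> h \<longleftrightarrow>
     \<epsilon> \<longlonglongrightarrow> 0 \<and>
     (\<forall>n. eps_isometry (\<epsilon> n) (Xs n) X (h n)) \<and>
     (\<forall>n. h n \<in> borel_metric (Xs n) \<rightarrow>\<^sub>M borel_metric X) \<and>
     weakly_converges X (\<lambda>n. distr (\<mu>s n) (borel_metric X) (h n)) \<mu>"

definition mGH_converges ::
    "(nat \<Rightarrow> 'a metric) \<Rightarrow> (nat \<Rightarrow> 'a measure) \<Rightarrow> 'b metric \<Rightarrow> 'b measure \<Rightarrow> bool" where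
  "mGH_converges Xs \<mu>s X \<mu> \<longleftrightarrow> (\<exists>\<epsilon> h. realizes_mGH_convergence Xs \<mu>s X \<mu> \<epsilon> h)"

definition center_sets :: "nat \<Rightarrow> 'a metric \<Rightarrow> 'a set set" where
  "center_sets k X = {S. S \<subseteq> mspace X \<and> finite S \<and> S \<noteq> {} \<and> card S \<le> k}"

definition distortion :: "real \<Rightarrow> 'a metric \<Rightarrow> 'a measure \<Rightarrow> 'a set \<Rightarrow> real" where
  "distortion p X \<mu> S = (LINT y|\<mu>. (MIN x\<in>S. mdist X y x powr p))"

definition k_means :: "nat \<Rightarrow> real \<Rightarrow> 'a metric \<Rightarrow> 'a measure \<Rightarrow> 'a set set" where
  "k_means k p X \<mu> = {S. is_arg_min (distortion p X \<mu>) (\<lambda>S. S \<in> center_sets k X) S}"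

definition voronoi_cell :: "'a metric \<Rightarrow> 'a set \<Rightarrow> 'a \<Rightarrow> 'a set" where
  "voronoi_cell X S b = {x \<in> mspace X. \<forall>b'\<in>S. mdist X x b \<le> mdist X x b'}"

definition voronoi :: "'a metric \<Rightarrow> 'a set \<Rightarrow> 'a set set" where
  "voronoi X S = voronoi_cell X S ` S"

text \<open>
  The maximum of \<open>d(v, W)\<close> over \<open>v \<in> V\<close>. As \<open>V\<close> is usually infinite, \<open>Max\<close> does not apply;
  \<open>GREATEST\<close> denotes the attained maximum (and is unspecified if there is none).
\<close>
definition max_dist :: "'a metric \<Rightarrow> 'a set \<Rightarrow> 'a set \<Rightarrow> real" where
  "max_dist X V W = (GREATEST r. r \<in> (\<lambda>v. point_dist X v W) ` V)"

end

theory Submission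
  imports Defs
begin

text \<open>
  If centres \<open>s n i\<close> have images under \<open>h n\<close> converging to points \<open>l i\<close>, then the distortion of the
  former converges to that of the latter: the integrands differ uniformly little after composing
  with \<open>h n\<close>, and weak convergence handles the limit integrand. Since every
  competitor in the limit space is such a limit, limits of \<open>k\<close>-means are \<open>k\<close>-means. If the Voronoi
  cells did not converge, compactness would give a subsequence along which the centres, and points
  of the cells far from all limit cells, converge; but the defining inequalities of a Voronoi cell
  are closed, so the limit point lies in the limit cell of the limit centre.
\<close>

section \<open>Distance estimates and sequential compactness\<close>

lemma mdist_self: "x \<in> mspace X \<Longrightarrow> mdist X x x = 0"
  by simp

lemma mdist_diff_le:
  assumes "x \<in> mspace X" "y \<in> mspace X" "x' \<in> mspace X" "y' \<in> mspace X"
  shows "\<bar>mdist X x y - mdist X x' y'\<bar> \<le> mdist X x x' + mdist X y y'"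
proof -
  have "mdist X x y \<le> mdist X x x' + mdist X x' y" "mdist X x' y \<le> mdist X x' y' + mdist X y' y"
    "mdist X x' y' \<le> mdist X x' x + mdist X x y'" "mdist X x y' \<le> mdist X x y + mdist X y y'"
    using assms by (auto intro: mdist_triangle)
  then show ?thesis
    by (simp add: mdist_commute[of X x' x] mdist_commute[of X y' y])
qed

lemma tendsto_mdist:
  assumes "(\<lambda>n. mdist X (x n) x') \<longlonglongrightarrow> 0" "(\<lambda>n. mdist X (y n) y') \<longlonglongrightarrow> 0"
    and "\<And>n. x n \<in> mspace X" "\<And>n. y n \<in> mspace X" "x' \<in> mspace X" "y' \<in> mspace X"
  shows "(\<lambda>n. mdist X (x n) (y n)) \<longlonglongrightarrow> mdist X x' y'"
proof (rule LIM_zero_cancel, rule Lim_null_comparison)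
  show "(\<lambda>n. mdist X (x n) x' + mdist X (y n) y') \<longlonglongrightarrow> 0"
    using tendsto_add[OF assms(1,2)] by simp
  show "\<forall>\<^sub>F n in sequentially.
      norm (mdist X (x n) (y n) - mdist X x' y') \<le> mdist X (x n) x' + mdist X (y n) y'"
    using assms mdist_diff_le[of _ X _ x' y'] by (intro always_eventually) auto
qed

text \<open>Sequential form of compactness for metric spaces. Convergence is recorded as real
  distances tending to 0, so that later limits can be taken in the reals.\<close>

lemma compact_space_convergent_subsequence:
  assumes "compact_space (mtopology_of X)" "\<And>n::nat. s n \<in> mspace X"
  obtains l r where "l \<in> mspace X" "strict_mono (r :: nat \<Rightarrow> nat)" "(\<lambda>n. mdist X (s (r n)) l) \<longlonglongrightarrow> 0"
proof -
  interpret X: Metric_space "mspace X" "mdist X" by (rule Metric_space_mspace_mdist)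
  have "\<exists>l r. l \<in> mspace X \<and> strict_mono r \<and> limitin X.mtopology (s \<circ> r) l sequentially"
    using assms X.compact_space_sequentially by (auto simp: mtopology_of_def)
  then show ?thesis
    using that by (auto simp: X.limitin_metric_dist_null)
qed

text \<open>Coordinates are treated one at a time: the induction step extracts a further subsequence
  for coordinate \<open>k\<close>, and the limits already found survive because a subsequence of a
  convergent sequence keeps its limit.\<close>

lemma compact_space_convergent_subsequence_family:
  fixes s :: "nat \<Rightarrow> nat \<Rightarrow> 'a"
  assumes "compact_space (mtopology_of X)" "\<And>n i. i < k \<Longrightarrow> s n i \<in> mspace X"
  shows "\<exists>l r. strict_mono (r :: nat \<Rightarrow> nat) \<and>
    (\<forall>i<k. l i \<in> mspace X \<and> (\<lambda>n. mdist X (s (r n) i) (l i)) \<longlonglongrightarrow> 0)"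
  using assms(2)
proof (induction k)
  case 0
  show ?case by (rule exI, rule exI[of _ id]) (auto simp: strict_mono_def)
next
  case (Suc k)
  then obtain l r where r: "strict_mono (r :: nat \<Rightarrow> nat)"
    and l: "\<And>i. i < k \<Longrightarrow> l i \<in> mspace X \<and> (\<lambda>n. mdist X (s (r n) i) (l i)) \<longlonglongrightarrow> 0"
    by (metis less_SucI)
  have "s (r n) k \<in> mspace X" for n using Suc.prems by simp
  then obtain l' r' where r': "strict_mono (r' :: nat \<Rightarrow> nat)" "l' \<in> mspace X"
    "(\<lambda>n. mdist X (s (r (r' n)) k) l') \<longlonglongrightarrow> 0"
    using compact_space_convergent_subsequence[OF assms(1), of "\<lambda>n. s (r n) k"] by blast
  have "(\<lambda>n. mdist X (s (r (r' n)) i) (l i)) \<longlonglongrightarrow> 0" if "i < k" for i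
    using LIMSEQ_subseq_LIMSEQ[OF conjunct2[OF l[OF that]] r'(1)] by (simp add: o_def)
  then show ?case
    using r r' l by (intro exI[of _ "l(k := l')"] exI[of _ "r \<circ> r'"])
      (auto simp: less_Suc_eq strict_mono_def)
qed

lemma compact_space_mdist_bounded:
  assumes "compact_space (mtopology_of X)"
  obtains D where "D \<ge> 0" "\<And>x y. x \<in> mspace X \<Longrightarrow> y \<in> mspace X \<Longrightarrow> mdist X x y \<le> D"
proof -
  interpret X: Metric_space "mspace X" "mdist X" by (rule Metric_space_mspace_mdist)
  have "X.mbounded (mspace X)"
    using assms X.compactin_imp_mbounded by (simp add: compact_space_def mtopology_of_def)
  then show ?thesis
    using that X.mbounded_alt_pos less_imp_le by metis
qed

section \<open>Distance to a set and Voronoi cells\<close>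

lemma bdd_below_mdist: "bdd_below (mdist X v ` W)"
  by (auto intro: bdd_belowI[of _ 0])

lemma point_dist_nonneg: "W \<noteq> {} \<Longrightarrow> 0 \<le> point_dist X v W"
  unfolding point_dist_def by (rule cINF_greatest) auto

lemma point_dist_le: "w \<in> W \<Longrightarrow> point_dist X v W \<le> mdist X v w"
  unfolding point_dist_def by (rule cINF_lower[OF bdd_below_mdist])

lemma point_dist_less_imp:
  "W \<noteq> {} \<Longrightarrow> point_dist X v W < e \<Longrightarrow> \<exists>w\<in>W. mdist X v w < e"
  unfolding point_dist_def by (simp add: cINF_less_iff bdd_below_mdist)

lemma point_dist_lipschitz:
  assumes "v \<in> mspace X" "v' \<in> mspace X" "W \<subseteq> mspace X" "W \<noteq> {}"
  shows "point_dist X v W \<le> mdist X v v' + point_dist X v' W"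
proof -
  have "point_dist X v W - mdist X v v' \<le> mdist X v' w" if "w \<in> W" for w
    using point_dist_le[OF that, of X v] mdist_triangle[of v X v' w] assms that by fastforce
  then have "point_dist X v W - mdist X v v' \<le> point_dist X v' W"
    unfolding point_dist_def[of X v' W] using assms by (intro cINF_greatest) auto
  then show ?thesis by simp
qed

lemma voronoi_cell_subset: "voronoi_cell X S b \<subseteq> mspace X"
  by (auto simp: voronoi_cell_def)

lemma center_in_voronoi_cell:
  "S \<subseteq> mspace X \<Longrightarrow> b \<in> S \<Longrightarrow> b \<in> voronoi_cell X S b"
  by (auto simp: voronoi_cell_def mdist_self subset_iff)

text \<open>The inequalities defining a cell are non-strict comparisons of distances, so they pass
  to the limit. It is enough that each point of \<open>S'\<close> is approached by points of
  \<open>S n\<close>. Constant \<open>S\<close> and \<open>b\<close> give closedness of a single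
  cell; varying ones give stability under convergence of centres.\<close>

lemma voronoi_cell_closed_sequentially:
  assumes "\<And>n. v n \<in> voronoi_cell X (S n) (b n)"
    and "(\<lambda>n. mdist X (v n) v') \<longlonglongrightarrow> 0" "v' \<in> mspace X"
    and "(\<lambda>n. mdist X (b n) b') \<longlonglongrightarrow> 0" "b' \<in> mspace X" "\<And>n. b n \<in> mspace X"
    and "\<And>c'. c' \<in> S' \<Longrightarrow> c' \<in> mspace X \<and>
      (\<exists>c. (\<forall>n. c n \<in> S n \<and> c n \<in> mspace X) \<and> (\<lambda>n. mdist X (c n) c') \<longlonglongrightarrow> 0)"
  shows "v' \<in> voronoi_cell X S' b'"
  unfolding voronoi_cell_def
proof (intro CollectI conjI ballI)
  fix c' assume "c' \<in> S'"
  then obtain c where c: "c' \<in> mspace X" "\<And>n. c n \<in> S n" "\<And>n. c n \<in> mspace X"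
    "(\<lambda>n. mdist X (c n) c') \<longlonglongrightarrow> 0"
    using assms(7) by blast
  have v: "v n \<in> mspace X" for n using assms(1) by (auto simp: voronoi_cell_def)
  show "mdist X v' b' \<le> mdist X v' c'"
  proof (rule LIMSEQ_le)
    show "(\<lambda>n. mdist X (v n) (b n)) \<longlonglongrightarrow> mdist X v' b'"
      using assms v by (intro tendsto_mdist) auto
    show "(\<lambda>n. mdist X (v n) (c n)) \<longlonglongrightarrow> mdist X v' c'"
      using assms c v by (intro tendsto_mdist) auto
    show "\<exists>N. \<forall>n\<ge>N. mdist X (v n) (b n) \<le> mdist X (v n) (c n)"
      using assms(1) c(2) by (auto simp: voronoi_cell_def)
  qed
qed (fact assms(3))

text \<open>A cell is nonempty and sequentially compact, and the distance to \<open>W\<close> is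
  1-Lipschitz, so its supremum over the cell is a maximum. This gives \<open>GREATEST\<close> in
  \<open>max_dist\<close> its intended value.\<close>

lemma max_dist_attained:
  assumes X: "compact_space (mtopology_of X)" and S: "S \<subseteq> mspace X" "b \<in> S"
    and W: "W \<subseteq> mspace X" "W \<noteq> {}"
  obtains v where "v \<in> voronoi_cell X S b" "max_dist X (voronoi_cell X S b) W = point_dist X v W"
    "\<And>v'. v' \<in> voronoi_cell X S b \<Longrightarrow> point_dist X v' W \<le> point_dist X v W"
proof -
  define V where "V = voronoi_cell X S b"
  have V: "V \<subseteq> mspace X" "b \<in> V"
    unfolding V_def by (rule voronoi_cell_subset, rule center_in_voronoi_cell[OF S])
  obtain D where D: "\<And>x y. x \<in> mspace X \<Longrightarrow> y \<in> mspace X \<Longrightarrow> mdist X x y \<le> D"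
    using compact_space_mdist_bounded[OF X] by blast
  obtain w where w: "w \<in> W" using W by blast
  have bdd: "bdd_above ((\<lambda>v. point_dist X v W) ` V)"
    using D V W w by (intro bdd_aboveI2[of _ _ D])
      (meson point_dist_le order_trans subsetD)
  define M where "M = (SUP v\<in>V. point_dist X v W)"
  \<comment> \<open>A maximizing sequence in the cell; the limit \<open>l\<close> of a subsequence
    will be the maximizer.\<close>
  have "\<exists>v\<in>V. M - inverse (real (Suc n)) < point_dist X v W" for n
    unfolding M_def using V bdd by (subst less_cSUP_iff[symmetric]) auto
  then obtain v where v: "\<And>n. v n \<in> V" "\<And>n. M - inverse (real (Suc n)) < point_dist X (v n) W"
    by metis
  then obtain l r where l: "l \<in> mspace X" "strict_mono (r :: nat \<Rightarrow> nat)" "(\<lambda>n. mdist X (v (r n)) l) \<longlonglongrightarrow> 0"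
    using compact_space_convergent_subsequence[OF X, of v] V by blast
  have lV: "l \<in> V"
    unfolding V_def
  proof (rule voronoi_cell_closed_sequentially[where v = "\<lambda>n. v (r n)" and S = "\<lambda>n. S" and b = "\<lambda>n. b"])
    fix c' assume "c' \<in> S"
    then show "c' \<in> mspace X \<and> (\<exists>c. (\<forall>n::nat. c n \<in> S \<and> c n \<in> mspace X) \<and> (\<lambda>n. mdist X (c n) c') \<longlonglongrightarrow> 0)"
      using S by (intro conjI exI[of _ "\<lambda>n. c'"]) (auto simp: mdist_self subset_iff)
  qed (use v l V S in \<open>auto simp: V_def mdist_self subset_iff\<close>)
  \<comment> \<open>Along the subsequence, \<open>M\<close> minus a vanishing error is below the
    distance of \<open>v (r n)\<close> to \<open>W\<close>, which exceeds that of \<open>l\<close>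
    by at most \<open>mdist X (v (r n)) l\<close>.\<close>
  have "M \<le> point_dist X l W"
  proof (rule LIMSEQ_le)
    have "(\<lambda>n. inverse (real (Suc (r n)))) \<longlonglongrightarrow> 0"
      using LIMSEQ_subseq_LIMSEQ[OF LIMSEQ_inverse_real_of_nat l(2)] by (simp add: o_def)
    then show "(\<lambda>n. M - inverse (real (Suc (r n)))) \<longlonglongrightarrow> M"
      using tendsto_diff[OF tendsto_const[of M]] by fastforce
    show "(\<lambda>n. mdist X (v (r n)) l + point_dist X l W) \<longlonglongrightarrow> point_dist X l W"
      using tendsto_add[OF l(3) tendsto_const] by simp
    show "\<exists>N. \<forall>n\<ge>N. M - inverse (real (Suc (r n))) \<le> mdist X (v (r n)) l + point_dist X l W"
      using v V l point_dist_lipschitz[OF _ l(1) W] by (meson less_imp_le order_trans subsetD)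
  qed
  moreover have le: "point_dist X v' W \<le> M" if "v' \<in> V" for v'
    unfolding M_def using that bdd by (rule cSUP_upper)
  ultimately have max: "point_dist X v' W \<le> point_dist X l W" if "v' \<in> V" for v'
    using that by fastforce
  have "max_dist X V W = point_dist X l W"
    unfolding max_dist_def using lV max by (intro Greatest_equality) auto
  then show ?thesis using that lV max unfolding V_def by blast
qed

section \<open>Continuity and integrability of the distortion integrand\<close>

text \<open>Evaluating \<open>f\<close> at an index where \<open>g\<close> is minimal bounds one
  difference, and exchanging the roles bounds the other. Both minima run over a common index set, so
  centres in different spaces can be compared pairwise.\<close>

lemma abs_Min_diff_le:
  fixes f g :: "'i \<Rightarrow> real"
  assumes "finite I" "I \<noteq> {}" "\<And>i. i \<in> I \<Longrightarrow> \<bar>f i - g i\<bar> \<le> e"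
  shows "\<bar>Min (f ` I) - Min (g ` I)\<bar> \<le> e"
proof -
  have *: "Min (f ` I) \<le> Min (g ` I) + e"
    if "\<And>i. i \<in> I \<Longrightarrow> \<bar>f i - g i\<bar> \<le> e" for f g :: "'i \<Rightarrow> real"
  proof -
    have "Min (g ` I) \<in> g ` I" using assms by (intro Min_in) auto
    then obtain i where i: "i \<in> I" "Min (g ` I) = g i" by blast
    have "Min (f ` I) \<le> f i" using assms i by simp
    then show ?thesis using that[OF i(1)] i(2) by linarith
  qed
  show ?thesis using *[of f g] *[of g f] assms(3) by (smt (verit))
qed

lemma sets_borel_metric:
  "sets (borel_metric X) = sigma_sets (mspace X) {U. openin (mtopology_of X) U}"
  "space (borel_metric X) = mspace X"
proof -
  have "{U. openin (mtopology_of X) U} \<subseteq> Pow (mspace X)"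
    using openin_subset[of "mtopology_of X"] by auto
  then show "sets (borel_metric X) = sigma_sets (mspace X) {U. openin (mtopology_of X) U}"
    "space (borel_metric X) = mspace X"
    by (auto simp: borel_metric_def)
qed

lemma space_compact_normalized:
  assumes "compact_normalized_mm_space X \<mu>"
  shows "space \<mu> = mspace X"
  using assms sets_eq_imp_space_eq[of \<mu> "borel_metric X"]
  by (simp add: compact_normalized_mm_space_def sets_borel_metric)

lemma borel_measurable_continuous_map:
  assumes "continuous_map (mtopology_of X) euclideanreal f"
  shows "f \<in> borel_measurable (borel_metric X)"
proof (rule borel_measurableI)
  fix U :: "real set" assume "open U"
  then have "openin (mtopology_of X) {x \<in> mspace X. f x \<in> U}"
    using openin_continuous_map_preimage[OF assms, of U] by simp
  then show "f -` U \<inter> space (borel_metric X) \<in> sets (borel_metric X)"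
    by (auto simp: sets_borel_metric vimage_def Collect_conj_eq Int_commute)
qed

lemma continuous_map_Min_powr:
  assumes "finite S" "S \<noteq> {}" "S \<subseteq> mspace X" "p \<ge> 1"
  shows "continuous_map (mtopology_of X) euclideanreal (\<lambda>y. MIN x\<in>S. mdist X y x powr p)"
proof -
  have c: "continuous_map (mtopology_of X) euclideanreal (\<lambda>y. mdist X y x powr p)"
    if "x \<in> mspace X" for x
  proof -
    \<comment> \<open>Distances are viewed as a map into the half-line, where \<open>powr\<close> is
      continuous up to 0 since the exponent is positive.\<close>
    have "continuous_map (mtopology_of X) (top_of_set {0..}) (\<lambda>y. mdist X y x)"
      using that by (auto simp: continuous_map_in_subtopology intro!: continuous_map_mdist)
    moreover have "continuous_on {0..} (\<lambda>t::real. t powr p)"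
      using assms(4) by (intro continuous_on_powr' continuous_intros) auto
    then have "continuous_map (top_of_set {0::real..}) euclideanreal (\<lambda>t. t powr p)"
      by simp
    ultimately show ?thesis
      using continuous_map_compose[of _ _ _ _ "\<lambda>t. t powr p"] by (fastforce simp: o_def)
  qed
  show ?thesis using assms(1-3)
  proof (induction S rule: finite_ne_induct)
    case (singleton x)
    then show ?case using c by simp
  next
    case (insert x S)
    then show ?case using c by (auto intro!: continuous_map_real_min)
  qed
qed

text \<open>The minimum is nonnegative and at most its value at one fixed centre, whose distance to
  \<open>y\<close> is at most the diameter bound \<open>D\<close>.\<close>

lemma Min_powr_bounded:
  assumes X: "compact_space (mtopology_of X)" and S: "finite S" "S \<noteq> {}" "S \<subseteq> mspace X" "p \<ge> 1"
  shows "\<exists>B. \<forall>y\<in>mspace X. \<bar>MIN x\<in>S. mdist X y x powr p\<bar> \<le> B"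
proof -
  obtain D where D: "D \<ge> 0" "\<And>x y. x \<in> mspace X \<Longrightarrow> y \<in> mspace X \<Longrightarrow> mdist X x y \<le> D"
    using compact_space_mdist_bounded[OF X] by blast
  obtain x where x: "x \<in> S" using S by blast
  have "\<bar>MIN x\<in>S. mdist X y x powr p\<bar> \<le> D powr p" if y: "y \<in> mspace X" for y
  proof -
    have "(MIN x\<in>S. mdist X y x powr p) \<le> mdist X y x powr p" using S x by simp
    also have "\<dots> \<le> D powr p" using D S x y by (intro powr_mono2) auto
    finally have "(MIN x\<in>S. mdist X y x powr p) \<le> D powr p" .
    moreover have "0 \<le> (MIN x\<in>S. mdist X y x powr p)" using S by simp
    ultimately show ?thesis by simp
  qed
  then show ?thesis by blast
qed

lemma integrable_Min_powr:
  assumes X: "compact_normalized_mm_space X \<mu>"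
    and S: "finite S" "S \<noteq> {}" "S \<subseteq> mspace X" "p \<ge> 1"
  shows "integrable \<mu> (\<lambda>y. MIN x\<in>S. mdist X y x powr p)"
proof -
  interpret prob_space \<mu> using X by (simp add: compact_normalized_mm_space_def)
  obtain B where "\<forall>y\<in>mspace X. \<bar>MIN x\<in>S. mdist X y x powr p\<bar> \<le> B"
    using Min_powr_bounded[OF _ S] X by (auto simp: compact_normalized_mm_space_def)
  moreover have "(\<lambda>y. MIN x\<in>S. mdist X y x powr p) \<in> borel_measurable \<mu>"
    using borel_measurable_continuous_map[OF continuous_map_Min_powr[OF S]] X
    by (simp add: compact_normalized_mm_space_def cong: measurable_cong_sets)
  ultimately show ?thesis
    using space_compact_normalized[OF X] by (intro integrable_const_bound[of _ B]) auto
qed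

section \<open>Convergence of the distortion along converging centres\<close>

text \<open>Centres are indexed families rather than sets, so distinct centres may merge in the
  limit: \<open>l\<close> need not be injective, and its image simply has fewer points.\<close>

lemma distortion_tendsto:
  fixes s :: "nat \<Rightarrow> nat \<Rightarrow> 'a"
  assumes k: "k \<ge> 1" and p: "p \<ge> 1"
    and Xs: "\<And>n. compact_normalized_mm_space (Xs n) (\<mu>s n)"
    and X: "compact_normalized_mm_space X \<mu>"
    and conv: "realizes_mGH_convergence Xs \<mu>s X \<mu> \<epsilon> h"
    and s: "\<And>n i. i < k \<Longrightarrow> s n i \<in> mspace (Xs n)"
    and l: "\<And>i. i < k \<Longrightarrow> l i \<in> mspace X"
    and lim: "\<And>i. i < k \<Longrightarrow> (\<lambda>n. mdist X (h n (s n i)) (l i)) \<longlonglongrightarrow> 0"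
  shows "(\<lambda>n. distortion p (Xs n) (\<mu>s n) (s n ` {..<k})) \<longlonglongrightarrow> distortion p X \<mu> (l ` {..<k})"
proof -
  define g where "g = (\<lambda>y. MIN x\<in>l ` {..<k}. mdist X y x powr p)"
  have l': "finite (l ` {..<k})" "l ` {..<k} \<noteq> {}" "l ` {..<k} \<subseteq> mspace X"
    using k l by (auto simp: lessThan_empty_iff)
  have g: "g \<in> borel_measurable (borel_metric X)"
    unfolding g_def by (intro borel_measurable_continuous_map continuous_map_Min_powr l' p)
  have Xc: "compact_space (mtopology_of X)" using X by (simp add: compact_normalized_mm_space_def)
  obtain B where B: "\<And>y. y \<in> mspace X \<Longrightarrow> \<bar>g y\<bar> \<le> B"
    unfolding g_def using Min_powr_bounded[OF Xc l' p] by blast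
  have \<epsilon>: "\<epsilon> \<longlonglongrightarrow> 0" and iso: "\<And>n. eps_isometry (\<epsilon> n) (Xs n) X (h n)"
    and hm: "\<And>n. h n \<in> borel_metric (Xs n) \<rightarrow>\<^sub>M borel_metric X"
    and weak: "weakly_converges X (\<lambda>n. distr (\<mu>s n) (borel_metric X) (h n)) \<mu>"
    using conv by (auto simp: realizes_mGH_convergence_def)
  have h: "h n y \<in> mspace X" if "y \<in> mspace (Xs n)" for n y
    using iso[of n] that by (auto simp: eps_isometry_def)
  have hm': "h n \<in> \<mu>s n \<rightarrow>\<^sub>M borel_metric X" for n
    using hm[of n] Xs[of n] by (simp add: compact_normalized_mm_space_def cong: measurable_cong_sets)
  have "bounded (g ` mspace X)"
    using B by (auto simp: bounded_iff)
  moreover have "continuous_map (mtopology_of X) euclideanreal g"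
    unfolding g_def by (intro continuous_map_Min_powr l' p)
  ultimately have "(\<lambda>n. LINT x|distr (\<mu>s n) (borel_metric X) (h n). g x) \<longlonglongrightarrow> (LINT x|\<mu>. g x)"
    using weak by (auto simp: weakly_converges_def)
  then have lim1: "(\<lambda>n. LINT y|\<mu>s n. g (h n y)) \<longlonglongrightarrow> distortion p X \<mu> (l ` {..<k})"
    using g hm' by (simp add: integral_distr distortion_def g_def)
  obtain D where D: "D \<ge> 0" "\<And>x y. x \<in> mspace X \<Longrightarrow> y \<in> mspace X \<Longrightarrow> mdist X x y \<le> D"
    using compact_space_mdist_bounded[OF Xc] by blast
  \<comment> \<open>Distances in \<open>X\<close> are at most \<open>D\<close>; those in
    \<open>Xs n\<close> exceed their counterparts under \<open>h n\<close> by less than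
    \<open>\<epsilon> n\<close>, hence stay below \<open>D + 1\<close> once
    \<open>\<epsilon> n < 1\<close>.\<close>
  have unif: "uniformly_continuous_on {0..D + 1} (\<lambda>t::real. t powr p)"
    using p by (intro compact_uniformly_continuous continuous_on_powr' continuous_intros) auto
  \<comment> \<open>Replacing the integrand on \<open>Xs n\<close> by \<open>g\<close> composed with
    \<open>h n\<close> costs a vanishing error; \<open>lim1\<close> then identifies the
    limit.\<close>
  have "(\<lambda>n. distortion p (Xs n) (\<mu>s n) (s n ` {..<k}) - (LINT y|\<mu>s n. g (h n y))) \<longlonglongrightarrow> 0"
  proof (rule LIMSEQ_I)
    fix e :: real assume e: "e > 0"
    \<comment> \<open>A pointwise error of \<open>e / 2\<close> integrates to at most
      \<open>e / 2\<close> against a probability measure, which leaves the strict bound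
      \<open>e\<close>.\<close>
    then obtain \<delta> where \<delta>: "\<delta> > 0" "\<And>t t'. t \<in> {0..D+1} \<Longrightarrow> t' \<in> {0..D+1} \<Longrightarrow> \<bar>t - t'\<bar> < \<delta>
        \<Longrightarrow> \<bar>t powr p - t' powr p\<bar> < e / 2"
      using unif unfolding uniformly_continuous_on_def dist_real_def by (meson half_gt_zero)
    \<comment> \<open>The budget \<open>\<delta>\<close> is shared equally between the isometry
      defect and the displacement of the centres; the bound 1 keeps the distances in the interval of
      uniform continuity.\<close>
    have "\<forall>\<^sub>F n in sequentially. \<epsilon> n < min 1 (\<delta> / 2)"
      using \<delta> by (intro order_tendstoD[OF \<epsilon>]) auto
    moreover have "\<forall>\<^sub>F n in sequentially. \<forall>i\<in>{..<k}. mdist X (h n (s n i)) (l i) < \<delta> / 2"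
      using \<delta> by (intro eventually_ball_finite ballI order_tendstoD[OF lim]) auto
    ultimately have "\<forall>\<^sub>F n in sequentially.
        \<bar>distortion p (Xs n) (\<mu>s n) (s n ` {..<k}) - (LINT y|\<mu>s n. g (h n y))\<bar> < e"
    proof eventually_elim
      case (elim n)
      have Sn: "finite (s n ` {..<k})" "s n ` {..<k} \<noteq> {}" "s n ` {..<k} \<subseteq> mspace (Xs n)"
        using k s by (auto simp: lessThan_empty_iff)
      interpret prob_space "\<mu>s n" using Xs by (simp add: compact_normalized_mm_space_def)
      have sp: "space (\<mu>s n) = mspace (Xs n)" by (rule space_compact_normalized[OF Xs])
      have pt: "\<bar>(MIN x\<in>s n ` {..<k}. mdist (Xs n) y x powr p) - g (h n y)\<bar> \<le> e / 2"
        if y: "y \<in> mspace (Xs n)" for y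
      proof -
        have "\<bar>mdist (Xs n) y (s n i) powr p - mdist X (h n y) (l i) powr p\<bar> \<le> e / 2" if i: "i < k" for i
        proof -
          have y': "h n y \<in> mspace X" "h n (s n i) \<in> mspace X"
            using h y s[OF i] by auto
          have 1: "\<bar>mdist (Xs n) y (s n i) - mdist X (h n y) (h n (s n i))\<bar> < \<epsilon> n"
            using iso[of n] y s[OF i] by (auto simp: eps_isometry_def)
          have 2: "\<bar>mdist X (h n y) (h n (s n i)) - mdist X (h n y) (l i)\<bar> < \<delta> / 2"
          proof -
            have "mdist X (h n (s n i)) (l i) < \<delta> / 2" using elim(2) i by simp
            then show ?thesis
              using mdist_diff_le[OF y' y'(1) l[OF i]] mdist_self[OF y'(1)] by linarith
          qed
          have "mdist X (h n y) (l i) \<le> D" "mdist X (h n y) (h n (s n i)) \<le> D"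
            using D(2) y' l[OF i] by auto
          with D(1) 1 elim(1) have "mdist (Xs n) y (s n i) \<in> {0..D+1}" "mdist X (h n y) (l i) \<in> {0..D+1}"
            by auto
          moreover have "\<bar>mdist (Xs n) y (s n i) - mdist X (h n y) (l i)\<bar> < \<delta>"
          proof -
            have "\<epsilon> n < \<delta> / 2" using elim(1) by simp
            with 1 2 show ?thesis by arith
          qed
          ultimately show ?thesis using \<delta>(2) less_imp_le by blast
        qed
        then show ?thesis
          using abs_Min_diff_le[of "{..<k}" "\<lambda>i. mdist (Xs n) y (s n i) powr p" "\<lambda>i. mdist X (h n y) (l i) powr p" "e/2"] k
          by (simp add: g_def image_image lessThan_empty_iff)
      qed
      have i1: "integrable (\<mu>s n) (\<lambda>y. MIN x\<in>s n ` {..<k}. mdist (Xs n) y x powr p)"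
        by (intro integrable_Min_powr Xs Sn p)
      have i2: "integrable (\<mu>s n) (\<lambda>y. g (h n y))"
        using B h sp measurable_compose[OF hm' g] by (intro integrable_const_bound[of _ B]) auto
      have "\<bar>LINT y|\<mu>s n. (MIN x\<in>s n ` {..<k}. mdist (Xs n) y x powr p) - g (h n y)\<bar>
          \<le> (LINT y|\<mu>s n. \<bar>(MIN x\<in>s n ` {..<k}. mdist (Xs n) y x powr p) - g (h n y)\<bar>)"
        by (rule integral_abs_bound)
      also have "\<dots> \<le> (LINT y|\<mu>s n. e / 2)"
        using i1 i2 pt sp by (intro integral_mono) auto
      also have "\<dots> < e" using e prob_space by simp
      finally show ?case using i1 i2 by (simp add: distortion_def)
    qed
    then show "\<exists>N. \<forall>n\<ge>N. norm (distortion p (Xs n) (\<mu>s n) (s n ` {..<k}) - (LINT y|\<mu>s n. g (h n y)) - 0) < e"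
      by (simp add: eventually_sequentially)
  qed
  from tendsto_add[OF this lim1] show ?thesis by simp
qed

section \<open>Enumerated centre sets, existence and limits of k-means\<close>

text \<open>List \<open>b\<close> first, then the other centres, and pad with \<open>b\<close> up to
  length \<open>k\<close>. A fixed number of indices makes coordinatewise subsequences possible, and
  index 0 keeps track of a chosen centre.\<close>

lemma center_sets_eq_image:
  assumes "S \<in> center_sets k X" "b \<in> S"
  shows "\<exists>s :: nat \<Rightarrow> 'a. s ` {..<k} = S \<and> s 0 = b \<and> (\<forall>i. s i \<in> S)"
proof -
  have S: "finite S" "card S \<le> k" using assms by (auto simp: center_sets_def)
  obtain xs where xs: "set xs = S - {b}" "distinct xs" using finite_distinct_list[of "S - {b}"] S by auto
  define s where "s i = (if i < length (b # xs) then (b # xs) ! i else b)" for i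
  have len: "length (b # xs) \<le> k"
    using distinct_card[OF xs(2)] xs(1) S assms(2) card_Suc_Diff1[OF S(1) assms(2)] by simp
  have set: "set (b # xs) = S" using xs assms by auto
  have mem: "s i \<in> S" for i
    using set nth_mem[of i "b # xs"] assms(2) unfolding s_def by presburger
  have "S \<subseteq> s ` {..<k}"
  proof
    fix x assume "x \<in> S"
    then obtain i where "i < length (b # xs)" "(b # xs) ! i = x" using set by (metis in_set_conv_nth)
    then show "x \<in> s ` {..<k}" using len by (intro image_eqI[of _ _ i]) (auto simp: s_def)
  qed
  then have "s ` {..<k} = S" using mem by blast
  moreover have "s 0 = b" by (simp add: s_def)
  ultimately show ?thesis using mem by blast
qed

lemma image_in_center_sets:
  assumes "k \<ge> 1" "\<And>i. i < k \<Longrightarrow> s i \<in> mspace X"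
  shows "s ` {..<k} \<in> center_sets k X"
  using assms card_image_le[of "{..<k}" s] by (auto simp: center_sets_def lessThan_empty_iff)

text \<open>Turns the convergence of distortions into continuity of the distortion on a single
  space. The errors are positive rather than 0 because the inequalities in
  \<open>eps_isometry\<close> are strict.\<close>

lemma realizes_mGH_convergence_const:
  assumes "compact_normalized_mm_space X \<mu>"
  shows "realizes_mGH_convergence (\<lambda>n. X) (\<lambda>n. \<mu>) X \<mu> (\<lambda>n. inverse (real (Suc n))) (\<lambda>n x. x)"
proof -
  have "point_dist X y (mspace X) < inverse (real (Suc n))" if "y \<in> mspace X" for y n
    using point_dist_le[OF that, of X y] that
    by (simp add: mdist_self le_less_trans[of _ 0] del: of_nat_Suc)
  then have "eps_isometry (inverse (real (Suc n))) X X (\<lambda>x. x)" for n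
    by (auto simp: eps_isometry_def)
  moreover have "distr \<mu> (borel_metric X) (\<lambda>x. x) = \<mu>"
    using assms by (intro distr_id2) (auto simp: compact_normalized_mm_space_def)
  ultimately show ?thesis
    by (simp add: realizes_mGH_convergence_def weakly_converges_def LIMSEQ_inverse_real_of_nat del: of_nat_Suc)
qed

lemma realizes_mGH_convergence_subseq:
  assumes "realizes_mGH_convergence Xs \<mu>s X \<mu> \<epsilon> h" "strict_mono r"
  shows "realizes_mGH_convergence (\<lambda>n. Xs (r n)) (\<lambda>n. \<mu>s (r n)) X \<mu> (\<lambda>n. \<epsilon> (r n)) (\<lambda>n. h (r n))"
proof -
  have "(\<lambda>n. u (r n)) \<longlonglongrightarrow> c" if "u \<longlonglongrightarrow> c" for u :: "nat \<Rightarrow> real" and c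
    using LIMSEQ_subseq_LIMSEQ[OF that assms(2)] by (simp add: o_def)
  then show ?thesis
    using assms(1) unfolding realizes_mGH_convergence_def weakly_converges_def by blast
qed

lemma k_means_iff:
  "S \<in> k_means k p X \<mu> \<longleftrightarrow>
    S \<in> center_sets k X \<and> (\<forall>T\<in>center_sets k X. distortion p X \<mu> S \<le> distortion p X \<mu> T)"
  by (auto simp: k_means_def is_arg_min_linorder)

lemma distortion_nonneg:
  assumes "S \<in> center_sets k X"
  shows "0 \<le> distortion p X \<mu> S"
  unfolding distortion_def using assms by (intro Bochner_Integration.integral_nonneg) (auto simp: center_sets_def)

text \<open>
  A minimizing sequence has a convergent subsequence; continuity of the distortion is the
  convergence result for the constant sequence of spaces.
\<close>

lemma k_means_nonempty:
  assumes k: "k \<ge> 1" and p: "p \<ge> 1" and X: "compact_normalized_mm_space X \<mu>"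
  shows "k_means k p X \<mu> \<noteq> {}"
proof -
  interpret prob_space \<mu> using X by (simp add: compact_normalized_mm_space_def)
  have Xc: "compact_space (mtopology_of X)" using X by (simp add: compact_normalized_mm_space_def)
  obtain x0 where "x0 \<in> mspace X" using not_empty space_compact_normalized[OF X] by auto
  then have ne: "center_sets k X \<noteq> {}" using image_in_center_sets[OF k, of "\<lambda>_. x0" X] by blast
  define m where "m = (INF S\<in>center_sets k X. distortion p X \<mu> S)"
  have bdd: "bdd_below (distortion p X \<mu> ` center_sets k X)"
    by (rule bdd_belowI2[of _ 0]) (rule distortion_nonneg)
  have m: "m \<le> distortion p X \<mu> T" if "T \<in> center_sets k X" for T
    unfolding m_def using bdd that by (rule cINF_lower)
  have "\<exists>S\<in>center_sets k X. distortion p X \<mu> S < m + inverse (real (Suc n))" for n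
    unfolding m_def using ne bdd by (subst cINF_less_iff[symmetric]) auto
  then obtain S where S: "\<And>n. S n \<in> center_sets k X" "\<And>n. distortion p X \<mu> (S n) < m + inverse (real (Suc n))"
    by metis
  have "\<exists>s. s ` {..<k} = S n" for n
  proof -
    obtain b where "b \<in> S n" using S(1)[of n] by (auto simp: center_sets_def)
    from center_sets_eq_image[OF S(1)[of n] this] show ?thesis by blast
  qed
  then obtain s where s: "\<And>n. s n ` {..<k} = S n" by metis
  have s': "s n i \<in> mspace X" if "i < k" for n i
    using S(1)[of n] s[of n] that by (auto simp: center_sets_def)
  obtain l r where r: "strict_mono (r :: nat \<Rightarrow> nat)"
    and l: "\<And>i. i < k \<Longrightarrow> l i \<in> mspace X" "\<And>i. i < k \<Longrightarrow> (\<lambda>n. mdist X (s (r n) i) (l i)) \<longlonglongrightarrow> 0"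
    using compact_space_convergent_subsequence_family[OF Xc, of k s] s' by blast
  have "(\<lambda>n. distortion p X \<mu> (s (r n) ` {..<k})) \<longlonglongrightarrow> distortion p X \<mu> (l ` {..<k})"
    using s' l by (intro distortion_tendsto[OF k p X X realizes_mGH_convergence_const[OF X]]) auto
  moreover have "(\<lambda>n. m + inverse (real (Suc (r n)))) \<longlonglongrightarrow> m + 0"
    using LIMSEQ_subseq_LIMSEQ[OF LIMSEQ_inverse_real_of_nat r] by (intro tendsto_add) (auto simp: o_def)
  ultimately have "distortion p X \<mu> (l ` {..<k}) \<le> m + 0"
    using S(2) s by (intro LIMSEQ_le) (auto intro: less_imp_le)
  then show ?thesis
    using m image_in_center_sets[OF k, of l X] l by (force simp: k_means_iff)
qed

text \<open>Each competitor \<open>T\<close> is approximated by images of centre sets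
  \<open>u n\<close> in \<open>Xs n\<close>. The inequality between the distortions of
  \<open>s n\<close> and \<open>u n\<close> holds by minimality, and both sides converge.\<close>

lemma limit_of_k_means:
  fixes s :: "nat \<Rightarrow> nat \<Rightarrow> 'a"
  assumes k: "k \<ge> 1" and p: "p \<ge> 1"
    and Xs: "\<And>n. compact_normalized_mm_space (Xs n) (\<mu>s n)"
    and X: "compact_normalized_mm_space X \<mu>"
    and conv: "realizes_mGH_convergence Xs \<mu>s X \<mu> \<epsilon> h"
    and s: "\<And>n. s n ` {..<k} \<in> k_means k p (Xs n) (\<mu>s n)"
    and l: "\<And>i. i < k \<Longrightarrow> l i \<in> mspace X"
    and lim: "\<And>i. i < k \<Longrightarrow> (\<lambda>n. mdist X (h n (s n i)) (l i)) \<longlonglongrightarrow> 0"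
  shows "l ` {..<k} \<in> k_means k p X \<mu>"
  unfolding k_means_iff
proof (intro conjI ballI)
  show "l ` {..<k} \<in> center_sets k X" by (rule image_in_center_sets[OF k l])
  have s': "s n i \<in> mspace (Xs n)" if "i < k" for n i
    using s[of n] that by (auto simp: k_means_iff center_sets_def)
  fix T assume T: "T \<in> center_sets k X"
  obtain t where t: "t ` {..<k} = T" "\<And>i. t i \<in> T"
  proof -
    obtain b where "b \<in> T" using T by (auto simp: center_sets_def)
    from center_sets_eq_image[OF T this] show ?thesis using that by blast
  qed
  have tX: "t i \<in> mspace X" for i using T t by (auto simp: center_sets_def)
  have \<epsilon>: "\<epsilon> \<longlonglongrightarrow> 0" and iso: "\<And>n. eps_isometry (\<epsilon> n) (Xs n) X (h n)"
    using conv by (auto simp: realizes_mGH_convergence_def)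
  \<comment> \<open>Almost surjectivity of \<open>h n\<close> supplies approximate preimages of the
    points of \<open>T\<close>. The image is nonempty because \<open>k \<ge> 1\<close> provides the
    centre \<open>s n 0\<close>, so the infimum is meaningful.\<close>
  have "\<exists>x\<in>mspace (Xs n). mdist X (t i) (h n x) < \<epsilon> n" for n i
  proof -
    have "h n ` mspace (Xs n) \<noteq> {}" using s'[of 0 n] k by auto
    from point_dist_less_imp[OF this, of X "t i" "\<epsilon> n"] show ?thesis
      using iso[of n] tX[of i] by (auto simp: eps_isometry_def)
  qed
  then obtain u where u: "\<And>n i. u n i \<in> mspace (Xs n)" "\<And>n i. mdist X (t i) (h n (u n i)) < \<epsilon> n"
    by metis
  have "(\<lambda>n. mdist X (h n (u n i)) (t i)) \<longlonglongrightarrow> 0" for i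
    using u(2)[of i] by (intro Lim_null_comparison[OF _ \<epsilon>] always_eventually)
      (auto simp: mdist_commute[of X _ "t i"] intro: less_imp_le)
  then have "(\<lambda>n. distortion p (Xs n) (\<mu>s n) (u n ` {..<k})) \<longlonglongrightarrow> distortion p X \<mu> (t ` {..<k})"
    using u tX by (intro distortion_tendsto[OF k p Xs X conv]) auto
  moreover have "(\<lambda>n. distortion p (Xs n) (\<mu>s n) (s n ` {..<k})) \<longlonglongrightarrow> distortion p X \<mu> (l ` {..<k})"
    using s' l lim by (intro distortion_tendsto[OF k p Xs X conv]) auto
  moreover have "distortion p (Xs n) (\<mu>s n) (s n ` {..<k}) \<le> distortion p (Xs n) (\<mu>s n) (u n ` {..<k})" for n
    using s[of n] image_in_center_sets[OF k u(1), of n] by (auto simp: k_means_iff)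
  ultimately show "distortion p X \<mu> (l ` {..<k}) \<le> distortion p X \<mu> T"
    using t(1) by (metis (no_types, lifting) LIMSEQ_le)
qed

section \<open>Convergence of the Voronoi cells\<close>

text \<open>The threshold on \<open>n\<close> is uniform over all k-means and all their cells, and
  one \<open>W\<close> serves the whole cell \<open>V\<close>. Arguing by contradiction lets
  compactness supply this uniformity.\<close>

lemma eventually_voronoi_near:
  assumes k: "k \<ge> 1" and p: "p \<ge> 1"
    and Xs: "\<And>n. compact_normalized_mm_space (Xs n) (\<mu>s n)"
    and X: "compact_normalized_mm_space X \<mu>"
    and conv: "realizes_mGH_convergence Xs \<mu>s X \<mu> \<epsilon> h"
    and e: "e > 0"
  shows "\<forall>\<^sub>F n in sequentially. \<forall>S\<in>k_means k p (Xs n) (\<mu>s n). \<forall>V\<in>voronoi X (h n ` S).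
    \<exists>W\<in>(\<Union>S\<in>k_means k p X \<mu>. voronoi X S). \<forall>v\<in>V. point_dist X v W < e"
proof (rule ccontr)
  \<comment> \<open>A bad cell is recorded through its centre \<open>b\<close> in
    \<open>Xs n\<close>, which can be placed at index 0 of an enumeration and followed to a
    limit.\<close>
  define bad where "bad n S b \<longleftrightarrow> S \<in> k_means k p (Xs n) (\<mu>s n) \<and> b \<in> S \<and>
    (\<forall>W\<in>(\<Union>S\<in>k_means k p X \<mu>. voronoi X S). \<exists>v\<in>voronoi_cell X (h n ` S) (h n b). e \<le> point_dist X v W)"
    for n S b
  assume "\<not> ?thesis"
  then have "\<exists>\<^sub>F n in sequentially. \<exists>S b. bad n S b"
    by (rule contrapos_np)
      (auto simp: frequently_def bad_def voronoi_def not_less elim!: eventually_mono, meson not_le)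
  then have "infinite {n. \<exists>S b. bad n S b}"
    by (simp add: frequently_cofinite flip: cofinite_eq_sequentially)
  from infinite_enumerate[OF this] obtain q :: "nat \<Rightarrow> nat" where q: "strict_mono q" "\<And>n. \<exists>S b. bad (q n) S b"
    by blast
  then obtain S b where bad: "\<And>n. bad (q n) (S n) (b n)" by metis
  have S: "S n \<in> k_means k p (Xs (q n)) (\<mu>s (q n))" "b n \<in> S n" for n
    using bad[of n] by (auto simp: bad_def)
  have "\<exists>s. s ` {..<k} = S n \<and> s 0 = b n" for n
  proof -
    have "S n \<in> center_sets k (Xs (q n))" using S(1)[of n] by (simp add: k_means_iff)
    from center_sets_eq_image[OF this S(2)[of n]] show ?thesis by blast
  qed
  then obtain s where s: "\<And>n. s n ` {..<k} = S n" "\<And>n. s n (0::nat) = b n" by metis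
  have sX: "s n i \<in> mspace (Xs (q n))" if "i < k" for n i
    using S(1)[of n] s(1)[of n] that by (auto simp: k_means_iff center_sets_def)
  have hX: "h n x \<in> mspace X" if "x \<in> mspace (Xs n)" for n x
    using conv that by (auto simp: realizes_mGH_convergence_def eps_isometry_def)
  have Xc: "compact_space (mtopology_of X)" using X by (simp add: compact_normalized_mm_space_def)
  \<comment> \<open>Three extractions are nested: \<open>q\<close> selects bad indices,
    \<open>r\<close> makes the centres converge, and \<open>t\<close> below makes the far points
    converge.\<close>
  obtain l r where r: "strict_mono (r :: nat \<Rightarrow> nat)"
    and l: "\<And>i. i < k \<Longrightarrow> l i \<in> mspace X"
      "\<And>i. i < k \<Longrightarrow> (\<lambda>n. mdist X (h (q (r n)) (s (r n) i)) (l i)) \<longlonglongrightarrow> 0"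
    using compact_space_convergent_subsequence_family[OF Xc, of k "\<lambda>n i. h (q n) (s n i)"] hX sX by blast
  have L: "l ` {..<k} \<in> k_means k p X \<mu>"
    using l s S
    by (intro limit_of_k_means[OF k p Xs X realizes_mGH_convergence_subseq[OF conv strict_mono_compose[OF q(1) r]],
          where s = "\<lambda>n. s (r n)"]) auto
  \<comment> \<open>Index 0 carries the bad centre, so this is the cell of its limit. It is fixed
    before any far point is chosen, since the far point supplied by \<open>bad\<close> depends on
    the limit cell.\<close>
  define W where "W = voronoi_cell X (l ` {..<k}) (l 0)"
  have W: "W \<in> (\<Union>S\<in>k_means k p X \<mu>. voronoi X S)"
    using L k by (force simp: voronoi_def W_def)
  have "\<exists>v\<in>voronoi_cell X (h (q (r n)) ` S (r n)) (h (q (r n)) (b (r n))). e \<le> point_dist X v W" for n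
    using bad[of "r n"] W unfolding bad_def by blast
  then obtain v where v: "\<And>n. v n \<in> voronoi_cell X (h (q (r n)) ` S (r n)) (h (q (r n)) (b (r n)))"
    "\<And>n. e \<le> point_dist X (v n) W"
    by metis
  have vX: "v n \<in> mspace X" for n using v(1)[of n] by (simp add: voronoi_cell_def)
  obtain v' t where t: "v' \<in> mspace X" "strict_mono (t :: nat \<Rightarrow> nat)" "(\<lambda>n. mdist X (v (t n)) v') \<longlonglongrightarrow> 0"
    using compact_space_convergent_subsequence[OF Xc, of v] vX by blast
  have lt: "(\<lambda>n. mdist X (h (q (r (t n))) (s (r (t n)) i)) (l i)) \<longlonglongrightarrow> 0" if "i < k" for i
    using LIMSEQ_subseq_LIMSEQ[OF l(2)[OF that] t(2)] by (simp add: o_def)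
  have "v' \<in> W"
    unfolding W_def
  proof (rule voronoi_cell_closed_sequentially[where v = "\<lambda>n. v (t n)"])
    show "v (t n) \<in> voronoi_cell X (h (q (r (t n))) ` S (r (t n))) (h (q (r (t n))) (s (r (t n)) 0))" for n
      using v(1)[of "t n"] s(2) by simp
    show "h (q (r (t n))) (s (r (t n)) 0) \<in> mspace X" for n using hX sX k by auto
    fix c' assume "c' \<in> l ` {..<k}"
    then obtain i where i: "i < k" "c' = l i" by auto
    then show "c' \<in> mspace X \<and> (\<exists>c. (\<forall>n. c n \<in> h (q (r (t n))) ` S (r (t n)) \<and> c n \<in> mspace X) \<and>
        (\<lambda>n. mdist X (c n) c') \<longlonglongrightarrow> 0)"
      using l(1) lt hX sX s(1)[symmetric]
      by (intro conjI exI[of _ "\<lambda>n. h (q (r (t n))) (s (r (t n)) i)"]) auto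
  qed (use t l lt k in auto)
  \<comment> \<open>Since \<open>v'\<close> lies in \<open>W\<close>, its distance to
    \<open>v (t n)\<close> bounds the distance to \<open>W\<close> from above; yet it tends to
    0.\<close>
  then have "e \<le> mdist X (v (t n)) v'" for n
    using v(2)[of "t n"] point_dist_le[of v' W X "v (t n)"] by simp
  then have "e \<le> 0" by (intro LIMSEQ_le_const[OF t(3)]) auto
  with e show False by simp
qed

section \<open>From nearby cells to the limit of suprema\<close>

theorem theorem2p7:
  fixes k :: nat and p :: real
    and Xs :: "nat \<Rightarrow> 'a metric" and \<mu>s :: "nat \<Rightarrow> 'a measure"
    and X :: "'b metric" and \<mu> :: "'b measure"
    and \<epsilon> :: "nat \<Rightarrow> real" and h :: "nat \<Rightarrow> 'a \<Rightarrow> 'b"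
  assumes "k \<ge> 1" and "p \<ge> 1"
    and "\<And>n. compact_normalized_mm_space (Xs n) (\<mu>s n)"
    and "compact_normalized_mm_space X \<mu>"
    and "mGH_converges Xs \<mu>s X \<mu>"
    and "realizes_mGH_convergence Xs \<mu>s X \<mu> \<epsilon> h"
    and "finite (k_means k p X \<mu>)"
  shows "(\<lambda>n. SUP V \<in> (\<Union>S \<in> k_means k p (Xs n) (\<mu>s n). voronoi X (h n ` S)).
                MIN W \<in> (\<Union>S \<in> k_means k p X \<mu>. voronoi X S). max_dist X V W)
         \<longlonglongrightarrow> 0"
proof -
  note k = assms(1) and p = assms(2) and Xs = assms(3) and X = assms(4) and conv = assms(6)
  define \<U> where "\<U> = (\<Union>S\<in>k_means k p X \<mu>. voronoi X S)"
  define \<U>s where "\<U>s n = (\<Union>S\<in>k_means k p (Xs n) (\<mu>s n). voronoi X (h n ` S))" for n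
  have Xc: "compact_space (mtopology_of X)" using X by (simp add: compact_normalized_mm_space_def)
  \<comment> \<open>Finitely many k-means with finitely many cells each make \<open>MIN\<close> over
    \<open>\<U>\<close> a genuine minimum; existence of k-means makes the family nonempty.\<close>
  have fin: "finite \<U>" "\<U> \<noteq> {}"
  proof -
    have "finite (voronoi X S)" "voronoi X S \<noteq> {}" if "S \<in> k_means k p X \<mu>" for S
      using that by (auto simp: voronoi_def k_means_iff center_sets_def)
    then show "finite \<U>" "\<U> \<noteq> {}"
      using assms(7) k_means_nonempty[OF k p X] by (auto simp: \<U>_def)
  qed
  have \<U>: "W \<subseteq> mspace X" "W \<noteq> {}" if W: "W \<in> \<U>" for W
  proof -
    obtain S b where S: "S \<in> k_means k p X \<mu>" "b \<in> S" "W = voronoi_cell X S b"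
      using W by (auto simp: \<U>_def voronoi_def)
    then have "S \<subseteq> mspace X" by (simp add: k_means_iff center_sets_def)
    with S(2) show "W \<subseteq> mspace X" "W \<noteq> {}"
      unfolding S(3) using voronoi_cell_subset[of X S b] center_in_voronoi_cell[of S X b] by auto
  qed
  have \<U>s_ne: "\<U>s n \<noteq> {}" for n
  proof -
    obtain S where S: "S \<in> k_means k p (Xs n) (\<mu>s n)" using k_means_nonempty[OF k p Xs] by blast
    then have "S \<noteq> {}" by (simp add: k_means_iff center_sets_def)
    with S show ?thesis by (auto simp: \<U>s_def voronoi_def)
  qed
  have attained: "\<exists>v\<in>V. max_dist X V W = point_dist X v W" if V: "V \<in> \<U>s n" and W: "W \<in> \<U>" for V W n
  proof -
    obtain S b where S: "S \<in> k_means k p (Xs n) (\<mu>s n)" "b \<in> S" "V = voronoi_cell X (h n ` S) (h n b)"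
      using V by (auto simp: \<U>s_def voronoi_def)
    have "S \<subseteq> mspace (Xs n)" using S(1) by (simp add: k_means_iff center_sets_def)
    moreover have "h n \<in> mspace (Xs n) \<rightarrow> mspace X"
      using conv by (simp add: realizes_mGH_convergence_def eps_isometry_def)
    ultimately have "h n ` S \<subseteq> mspace X" "h n b \<in> h n ` S" using S(2) by auto
    from max_dist_attained[OF Xc this \<U>[OF W]]
    obtain v where "v \<in> V" "max_dist X V W = point_dist X v W"
      unfolding S(3) by blast
    then show ?thesis by blast
  qed
  have nonneg: "0 \<le> (MIN W\<in>\<U>. max_dist X V W)" if V: "V \<in> \<U>s n" for V n
  proof -
    have "0 \<le> max_dist X V W" if "W \<in> \<U>" for W
      using attained[OF V that] point_dist_nonneg[OF \<U>(2)[OF that]] by auto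
    with fin show ?thesis by simp
  qed
  have "(\<lambda>n. SUP V\<in>\<U>s n. MIN W\<in>\<U>. max_dist X V W) \<longlonglongrightarrow> 0"
  proof (rule LIMSEQ_I)
    fix e :: real assume e: "e > 0"
    \<comment> \<open>Cells are taken within \<open>e / 2\<close>, because the supremum preserves
      only the non-strict bound.\<close>
    have "\<forall>\<^sub>F n in sequentially. norm ((SUP V\<in>\<U>s n. MIN W\<in>\<U>. max_dist X V W) - 0) < e"
      using eventually_voronoi_near[OF k p Xs X conv half_gt_zero[OF e]]
    proof eventually_elim
      case (elim n)
      have le: "(MIN W\<in>\<U>. max_dist X V W) \<le> e / 2" if V: "V \<in> \<U>s n" for V
      proof -
        obtain W where W: "W \<in> \<U>" "\<And>v. v \<in> V \<Longrightarrow> point_dist X v W < e / 2"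
        proof -
          from V obtain S where "S \<in> k_means k p (Xs n) (\<mu>s n)" "V \<in> voronoi X (h n ` S)"
            by (auto simp: \<U>s_def)
          with elim have "\<exists>W\<in>\<U>. \<forall>v\<in>V. point_dist X v W < e / 2" unfolding \<U>_def by simp
          then show ?thesis using that by blast
        qed
        have "(MIN W\<in>\<U>. max_dist X V W) \<le> max_dist X V W" using fin W by simp
        also have "\<dots> \<le> e / 2" using attained[OF V W(1)] W(2) less_imp_le by metis
        finally show ?thesis .
      qed
      \<comment> \<open>The real supremum is conditional: boundedness and a member of
        \<open>\<U>s n\<close> are what turn nonnegativity of the minima into nonnegativity of their
        supremum.\<close>
      have "bdd_above ((\<lambda>V. MIN W\<in>\<U>. max_dist X V W) ` \<U>s n)"
        using le by (rule bdd_aboveI2)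
      moreover obtain V where "V \<in> \<U>s n" using \<U>s_ne by blast
      ultimately have "0 \<le> (SUP V\<in>\<U>s n. MIN W\<in>\<U>. max_dist X V W)"
        using nonneg by (meson cSUP_upper2)
      moreover have "(SUP V\<in>\<U>s n. MIN W\<in>\<U>. max_dist X V W) \<le> e / 2"
        using \<U>s_ne le by (rule cSUP_least)
      ultimately show ?case using e by simp
    qed
    then show "\<exists>N. \<forall>n\<ge>N. norm ((SUP V\<in>\<U>s n. MIN W\<in>\<U>. max_dist X V W) - 0) < e"
      by (simp add: eventually_sequentially)
  qed
  then show ?thesis by (simp add: \<U>_def \<U>s_def)
qed

end
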